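(* Let $T$ be a finite tree of order $n(T)\ge 3$ and let $q$ be a positive integer such that $T$ is $q$-critical. Then $1\le q\le n(T)-1$. Moreover, both bounds are tight: there exists a tree of order at least $3$ which is $1$-critical, and there exists a tree $T$ of order at least $3$ which is $(n(T)-1)$-critical.
   Context: All graphs are finite and simple; $n(G)$ is the number of vertices of $G$. A set $D\subseteq V(G)$ is dominating if every vertex of $V(G)\setminus D$ has a neighbour in $D$; $\gamma(G)$ is the minimum cardinality of a dominating set of $G$. For $F\subseteq E(G)$, $G_F$ denotes the graph obtained from $G$ by subdividing each edge of $F$ exactly once (each edge $uv\in F$ is replaced by a path $u,w,v$ with a new vertex $w$). For an integer $q\ge 1$, a connected graph $G$ of order at least $3$ is called $q$-critical ($\gamma$-$q$-critical) if $\gamma(G_F)>\gamma(G)$ for every $F\subseteq E(G)$ with $|F|=q$, and there is a set $F'\subseteq E(G)$ with $|F'|=q-1$ such that $\gamma(G_{F'})=\gamma(G)$ (so $q$ is the smallest number such that subdividing any $q$ edges necessarily increases the domination number). *)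

theory Defs
  imports Main
begin

record 'a ugraph =
  verts :: "'a set"
  edges :: "'a set set"

definition simple_graph :: "'a ugraph \<Rightarrow> bool" where
  "simple_graph G \<longleftrightarrow>
     finite (verts G) \<and> (\<forall>e\<in>edges G. e \<subseteq> verts G \<and> card e = 2)"

definition order_of :: "'a ugraph \<Rightarrow> nat" where
  "order_of G = card (verts G)"

definition adjacent :: "'a ugraph \<Rightarrow> 'a \<Rightarrow> 'a \<Rightarrow> bool" where
  "adjacent G u v \<longleftrightarrow> {u, v} \<in> edges G"

definition connected_graph :: "'a ugraph \<Rightarrow> bool" where
  "connected_graph G \<longleftrightarrow>
     verts G \<noteq> {} \<and> (\<forall>u\<in>verts G. \<forall>v\<in>verts G. (adjacent G)\<^sup>*\<^sup>* u v)"

text \<open>A cycle is listed without repeating its first vertex at the end.\<close>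

definition is_cycle :: "'a ugraph \<Rightarrow> 'a list \<Rightarrow> bool" where
  "is_cycle G p \<longleftrightarrow>
     length p \<ge> 3 \<and> distinct p \<and>
     (\<forall>i<length p. adjacent G (p ! i) (p ! (Suc i mod length p)))"

definition is_tree :: "'a ugraph \<Rightarrow> bool" where
  "is_tree G \<longleftrightarrow> simple_graph G \<and> connected_graph G \<and> (\<nexists>p. is_cycle G p)"

definition dominating :: "'a ugraph \<Rightarrow> 'a set \<Rightarrow> bool" where
  "dominating G D \<longleftrightarrow>
     D \<subseteq> verts G \<and> (\<forall>v \<in> verts G - D. \<exists>u\<in>D. adjacent G v u)"

definition domination_number :: "'a ugraph \<Rightarrow> nat" (\<open>\<gamma>\<close>) where
  "\<gamma> G = (LEAST k. \<exists>D. dominating G D \<and> card D = k)"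

text \<open>The graph \<open>G\<^sub>F\<close>: an original vertex \<open>v\<close> becomes \<open>Inl v\<close>, and \<open>Inr e\<close> is the new
  vertex placed on the edge \<open>e \<in> F\<close>.\<close>

definition subdivide :: "'a ugraph \<Rightarrow> 'a set set \<Rightarrow> ('a + 'a set) ugraph" where
  "subdivide G F =
     \<lparr> verts = Inl ` verts G \<union> Inr ` F,
       edges = {Inl ` e |e. e \<in> edges G - F} \<union> {{Inl u, Inr e} |u e. e \<in> F \<and> u \<in> e} \<rparr>"

definition critical :: "nat \<Rightarrow> 'a ugraph \<Rightarrow> bool" where
  "critical q G \<longleftrightarrow>
     q \<ge> 1 \<and> simple_graph G \<and> connected_graph G \<and> order_of G \<ge> 3 \<and>
     (\<forall>F. F \<subseteq> edges G \<and> card F = q \<longrightarrow> \<gamma> (subdivide G F) > \<gamma> G) \<and>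
     (\<exists>F'. F' \<subseteq> edges G \<and> card F' = q - 1 \<and> \<gamma> (subdivide G F') = \<gamma> G)"

end

(* Let D dominate the full subdivision of a connected graph G with at least three vertices, let A
   be the set of original vertices in D and B the set of edges whose subdivision vertex lies in D.
   Keeping A and replacing every edge of B by one of its ends gives a dominating set of G. One
   vertex can always be saved: if B is empty then A contains every vertex and any one of them can
   go; if an edge of B has an end in A, no replacement is needed for it; otherwise let uv be in B
   and w a third vertex adjacent to v, and choose v to replace uv. Either w is in A and can be
   dropped, being dominated by v, or vw is in B (its subdivision vertex must be dominated) and
   needs no replacement of its own. So subdividing all edges raises the domination number; hence
   q is at most the number of edges, which for a tree is at most n - 1. The paths on three and
   four vertices attain the bounds. *)

theory Submission
  imports Defs
begin

section \<open>Acyclic graphs\<close>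

lemma adjacent_sym: "adjacent G u v \<longleftrightarrow> adjacent G v u"
  by (simp add: adjacent_def insert_commute)

lemma simple_graph_adjacentD:
  assumes "simple_graph G" "adjacent G u v"
  shows "u \<in> verts G" "v \<in> verts G" "u \<noteq> v"
  using assms by (fastforce simp: simple_graph_def adjacent_def)+

lemma simple_graph_edgeE:
  assumes "simple_graph G" "e \<in> edges G"
  obtains u v where "e = {u, v}" "u \<noteq> v" "adjacent G u v"
proof -
  have "card e = 2" using assms by (auto simp: simple_graph_def)
  then obtain u v where "e = {u, v}" "u \<noteq> v" by (auto simp: card_2_iff)
  with assms(2) show thesis by (intro that) (auto simp: adjacent_def)
qed

lemma simple_graph_adjacentI:
  assumes "simple_graph G" "e \<in> edges G" "x \<in> e" "y \<in> e" "x \<noteq> y"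
  shows "adjacent G x y"
proof -
  obtain u v where "e = {u, v}" "adjacent G u v"
    using simple_graph_edgeE[OF assms(1,2)] by blast
  with assms(3-5) show ?thesis using adjacent_sym[of G u v] by auto
qed

lemma simple_graph_edge_nonempty: "simple_graph G \<Longrightarrow> e \<in> edges G \<Longrightarrow> \<exists>x. x \<in> e"
  by (erule simple_graph_edgeE) auto

lemma simple_graph_edge_subset: "simple_graph G \<Longrightarrow> e \<in> edges G \<Longrightarrow> x \<in> e \<Longrightarrow> x \<in> verts G"
  by (auto simp: simple_graph_def)

lemma finite_edges: "simple_graph G \<Longrightarrow> finite (edges G)"
  by (rule finite_subset[of _ "Pow (verts G)"]) (auto simp: simple_graph_def)

text \<open>If every vertex had two distinct neighbours, a path could be extended at its head
  forever: some neighbour of the head differs from the second vertex, and it cannot lie on the path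
  without closing a cycle. Finiteness of the vertex set bounds the length of a path.\<close>

lemma acyclic_exists_low_degree:
  assumes G: "simple_graph G" "verts G \<noteq> {}" "\<nexists>p. is_cycle G p"
  obtains x where "x \<in> verts G" "\<And>y z. adjacent G x y \<Longrightarrow> adjacent G x z \<Longrightarrow> y = z"
proof (rule ccontr)
  assume "\<not> thesis"
  then have deg: "\<exists>y z. adjacent G x y \<and> adjacent G x z \<and> y \<noteq> z" if "x \<in> verts G" for x
    using that \<open>\<And>x. \<lbrakk>x \<in> verts G; \<And>y z. \<lbrakk>adjacent G x y; adjacent G x z\<rbrakk> \<Longrightarrow> y = z\<rbrakk> \<Longrightarrow> thesis\<close>
    by blast
  have "\<exists>p. length p = Suc n \<and> distinct p \<and> set p \<subseteq> verts G \<and>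
          (\<forall>i. Suc i < length p \<longrightarrow> adjacent G (p ! i) (p ! Suc i))" for n
  proof (induction n)
    case 0
    obtain x where "x \<in> verts G" using G by blast
    then show ?case by (intro exI[of _ "[x]"]) auto
  next
    case (Suc n)
    then obtain p where p: "length p = Suc n" "distinct p" "set p \<subseteq> verts G"
      and adj: "\<And>i. Suc i < length p \<Longrightarrow> adjacent G (p ! i) (p ! Suc i)" by blast
    have "p ! 0 \<in> verts G" using p by auto
    then obtain y where y: "adjacent G (p ! 0) y" "\<not> (Suc 0 < length p \<and> y = p ! Suc 0)"
      using deg by metis
    have "y \<notin> set p"
    proof
      assume "y \<in> set p"
      then obtain j where j: "j < length p" "y = p ! j" by (metis in_set_conv_nth)
      have "p ! 0 \<noteq> y" using simple_graph_adjacentD[OF G(1) y(1)] by simp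
      \<comment> \<open>\<open>y\<close> is not the head, since there are no loops, and not the
        second vertex, by choice. So the segment from the head to \<open>y\<close> has at least
        three vertices and is closed by the edge back to the head.\<close>
      with j y(2) have j2: "j \<ge> 2"
        by (metis One_nat_def less_2_cases not_less)
      have len: "length (take (Suc j) p) = Suc j" using j by simp
      have "is_cycle G (take (Suc j) p)"
        unfolding is_cycle_def
      proof (intro conjI allI impI)
        fix i assume i: "i < length (take (Suc j) p)"
        show "adjacent G (take (Suc j) p ! i)
                (take (Suc j) p ! (Suc i mod length (take (Suc j) p)))"
        proof (cases "i = j")
          case True
          then show ?thesis using j y(1) by (simp only: len) (simp add: adjacent_sym)
        next
          case False
          then have "i < j" using i by simp
          then show ?thesis using j adj[of i] by (simp only: len) simp
        qed
      qed (use j j2 p in auto)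
      with G(3) show False by blast
    qed
    then show ?case
      using p y(1) adj simple_graph_adjacentD[OF G(1) y(1)]
      by (intro exI[of _ "y # p"]) (auto simp: nth_Cons adjacent_sym split: nat.splits)
  qed
  then obtain p where p: "length p = Suc (card (verts G))" "distinct p" "set p \<subseteq> verts G"
    by blast
  moreover have "finite (verts G)" using G by (simp add: simple_graph_def)
  ultimately have "length p \<le> card (verts G)" by (metis card_mono distinct_card)
  with p show False by simp
qed

text \<open>Induction on the number of vertices: deleting a vertex with at most one neighbour loses
  at most one edge. The claim concerns forests, a class closed under deleting vertices.\<close>

lemma acyclic_card_edges:
  assumes "simple_graph G" "verts G \<noteq> {}" "\<nexists>p. is_cycle G p"
  shows "card (edges G) + 1 \<le> card (verts G)"
  using assms
proof (induction "card (verts G)" arbitrary: G rule: less_induct)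
  case less
  obtain x where x: "x \<in> verts G" "\<And>y z. adjacent G x y \<Longrightarrow> adjacent G x z \<Longrightarrow> y = z"
    using acyclic_exists_low_degree[OF less.prems] by blast
  have fin: "finite (verts G)" using less.prems by (simp add: simple_graph_def)
  define H where "H = \<lparr>verts = verts G - {x}, edges = {e \<in> edges G. x \<notin> e}\<rparr>"
  have H: "simple_graph H" using less.prems(1) by (auto simp: simple_graph_def H_def)
  have adjH: "adjacent H u v \<Longrightarrow> adjacent G u v" for u v
    by (simp add: adjacent_def H_def)
  have acyc: "\<nexists>p. is_cycle H p"
    using less.prems(3) adjH unfolding is_cycle_def by blast
  have uniq: "e = f" if ef: "e \<in> edges G" "x \<in> e" "f \<in> edges G" "x \<in> f" for e f
  proof -
    have "\<exists>y. e = {x, y} \<and> adjacent G x y" if "e \<in> edges G" "x \<in> e" for e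
      using simple_graph_edgeE[OF less.prems(1) that(1)] that(2)
      by (metis adjacent_sym insert_commute insert_iff singletonD)
    with ef x(2) show ?thesis by metis
  qed
  have "card {e \<in> edges G. x \<in> e} \<le> 1"
    using uniq finite_edges[OF less.prems(1)] by (auto simp: card_le_Suc0_iff_eq)
  moreover have "card (edges G) = card (edges H \<union> {e \<in> edges G. x \<in> e})"
    by (rule arg_cong[of _ _ card]) (auto simp: H_def)
  ultimately have le: "card (edges G) \<le> card (edges H) + 1"
    using card_Un_le[of "edges H" "{e \<in> edges G. x \<in> e}"] by linarith
  have cV: "card (verts G) = Suc (card (verts H))"
    using x(1) fin by (simp add: H_def card_Suc_Diff1 del: card_Diff_insert)
  show ?case
  proof (cases "verts H = {}")
    case True
    have "edges G = {}"
    proof (rule ccontr)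
      assume "edges G \<noteq> {}"
      then obtain u v where "adjacent G u v" using less.prems(1) simple_graph_edgeE by blast
      then show False
        using simple_graph_adjacentD[OF less.prems(1), of u v] True by (auto simp: H_def)
    qed
    then show ?thesis using cV by simp
  next
    case False
    then show ?thesis using less.hyps[of H] H acyc cV le by simp
  qed
qed

section \<open>Domination in subdivisions\<close>

lemma domination_number_le: "dominating G D \<Longrightarrow> \<gamma> G \<le> card D"
  unfolding domination_number_def by (rule Least_le) blast

lemma minimum_dominating_setE:
  obtains D where "dominating G D" "card D = \<gamma> G"
proof -
  have "dominating G (verts G)" by (simp add: dominating_def)
  then have "\<exists>k D. dominating G D \<and> card D = k" by blast
  then have "\<exists>D. dominating G D \<and> card D = \<gamma> G"
    unfolding domination_number_def by (rule LeastI_ex)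
  with that show thesis by blast
qed

lemma adjacent_subdivide [simp]:
  "adjacent (subdivide G F) (Inl u) (Inl v) \<longleftrightarrow> {u, v} \<in> edges G - F"
  "adjacent (subdivide G F) (Inl u) (Inr e) \<longleftrightarrow> e \<in> F \<and> u \<in> e"
  "adjacent (subdivide G F) (Inr e) (Inl u) \<longleftrightarrow> e \<in> F \<and> u \<in> e"
  "\<not> adjacent (subdivide G F) (Inr e) (Inr f)"
proof -
  have eq: "{Inl u, Inl v} = Inl ` e \<longleftrightarrow> e = {u, v}" for e
    using inj_image_eq_iff[of Inl "{u, v}" e] by auto
  have ne: "{Inl u, Inl v} \<noteq> {Inl a, Inr b}" for a b by (auto simp: doubleton_eq_iff)
  have ne': "{Inl u, Inr e} \<noteq> Inl ` f" "{Inr e, Inl u} \<noteq> Inl ` f" for f by auto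
  have adj: "adjacent (subdivide G F) x y \<longleftrightarrow>
      (\<exists>e. {x, y} = Inl ` e \<and> e \<in> edges G - F) \<or>
      (\<exists>u e. {x, y} = {Inl u, Inr e} \<and> e \<in> F \<and> u \<in> e)" for x y
    unfolding adjacent_def subdivide_def by simp
  show "adjacent (subdivide G F) (Inl u) (Inl v) \<longleftrightarrow> {u, v} \<in> edges G - F"
    unfolding adj eq by (simp add: ne)
  show "adjacent (subdivide G F) (Inl u) (Inr e) \<longleftrightarrow> e \<in> F \<and> u \<in> e"
    unfolding adj by (simp add: ne' doubleton_eq_iff)
  then show "adjacent (subdivide G F) (Inr e) (Inl u) \<longleftrightarrow> e \<in> F \<and> u \<in> e"
    by (simp add: adjacent_sym)
  show "\<not> adjacent (subdivide G F) (Inr e) (Inr f)"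
    unfolding adj by (auto simp: doubleton_eq_iff)
qed

lemma verts_subdivide: "verts (subdivide G F) = Inl ` verts G \<union> Inr ` F"
  by (simp add: subdivide_def)

text \<open>Every vertex set of the subdivision splits into original vertices \<open>A\<close> and
  edges \<open>B\<close>. This criterion lets the later proofs argue about \<open>A\<close> and
  \<open>B\<close> inside \<open>G\<close>.\<close>

lemma dominating_subdivide_iff:
  "dominating (subdivide G F) (Inl ` A \<union> Inr ` B) \<longleftrightarrow>
     A \<subseteq> verts G \<and> B \<subseteq> F \<and>
     (\<forall>v \<in> verts G - A. (\<exists>u\<in>A. {v, u} \<in> edges G - F) \<or> (\<exists>e\<in>B. e \<in> F \<and> v \<in> e)) \<and>
     (\<forall>e \<in> F - B. \<exists>u\<in>A. u \<in> e)"
proof -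
  have diff: "Inl ` V \<union> Inr ` F - (Inl ` A \<union> Inr ` B) = Inl ` (V - A) \<union> Inr ` (F - B)" for V
    by auto
  have sub: "Inl ` A \<union> Inr ` B \<subseteq> Inl ` V \<union> Inr ` F \<longleftrightarrow> A \<subseteq> V \<and> B \<subseteq> F" for V
    by auto
  show ?thesis
    unfolding dominating_def verts_subdivide diff sub ball_Un bex_Un ball_simps bex_simps by auto
qed

lemma minimum_dominating_subdivideE:
  assumes "simple_graph G" "F \<subseteq> edges G"
  obtains A B where "dominating (subdivide G F) (Inl ` A \<union> Inr ` B)"
    "finite A" "finite B" "\<gamma> (subdivide G F) = card A + card B"
proof -
  obtain D where D: "dominating (subdivide G F) D" "card D = \<gamma> (subdivide G F)"
    by (rule minimum_dominating_setE)
  define A B where "A = Inl -` D" and "B = Inr -` D"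
  have eq: "D = Inl ` A \<union> Inr ` B"
  proof (rule set_eqI)
    show "x \<in> D \<longleftrightarrow> x \<in> Inl ` A \<union> Inr ` B" for x
      by (cases x) (auto simp: A_def B_def)
  qed
  have "A \<subseteq> verts G" "B \<subseteq> F"
    using D(1) unfolding eq dominating_subdivide_iff by auto
  then have fin: "finite A" "finite B"
    using assms finite_edges[OF assms(1)] by (auto simp: simple_graph_def intro: finite_subset)
  have "card D = card A + card B"
    unfolding eq using fin by (subst card_Un_disjoint) (auto simp: card_image)
  with D eq fin show thesis by (intro that) auto
qed

text \<open>Each edge of \<open>B\<close> is replaced by one of its ends. A vertex dominated by a
  subdivision vertex is an end of that edge, hence equal or adjacent to the chosen end. For the
  paths below this leaves one inequality to check in
  \<open>\<gamma> (subdivide G F') = \<gamma> G\<close>.\<close>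

lemma domination_number_le_subdivide:
  assumes G: "simple_graph G" and F: "F \<subseteq> edges G"
  shows "\<gamma> G \<le> \<gamma> (subdivide G F)"
proof -
  obtain A B where AB: "dominating (subdivide G F) (Inl ` A \<union> Inr ` B)"
    "finite A" "finite B" "\<gamma> (subdivide G F) = card A + card B"
    using minimum_dominating_subdivideE[OF assms] by blast
  have A: "A \<subseteq> verts G" and B: "B \<subseteq> edges G"
    and cover: "\<And>v. v \<in> verts G \<Longrightarrow> v \<notin> A \<Longrightarrow>
      (\<exists>u\<in>A. {v, u} \<in> edges G) \<or> (\<exists>e\<in>B. v \<in> e)"
    using AB(1) F unfolding dominating_subdivide_iff by blast+
  have "\<forall>e\<in>B. \<exists>x. x \<in> e" using B simple_graph_edge_nonempty[OF G] by blast
  then obtain c where c: "\<And>e. e \<in> B \<Longrightarrow> c e \<in> e" by metis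
  have "dominating G (A \<union> c ` B)"
    unfolding dominating_def
  proof (intro conjI ballI)
    show "A \<union> c ` B \<subseteq> verts G" using A B c simple_graph_edge_subset[OF G] by blast
    fix v assume v: "v \<in> verts G - (A \<union> c ` B)"
    with cover consider u where "u \<in> A" "{v, u} \<in> edges G" | e where "e \<in> B" "v \<in> e" by blast
    then show "\<exists>u\<in>A \<union> c ` B. adjacent G v u"
    proof cases
      case 1
      then show ?thesis by (auto simp: adjacent_def)
    next
      case (2 e)
      then have "adjacent G v (c e)"
        using B c v by (intro simple_graph_adjacentI[OF G, of e]) auto
      with 2 show ?thesis by blast
    qed
  qed
  then have "\<gamma> G \<le> card (A \<union> c ` B)" by (rule domination_number_le)
  also have "\<dots> \<le> card A + card B"
    by (meson AB(3) add_left_mono card_Un_le card_image_le order_trans)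
  finally show ?thesis using AB by simp
qed

section \<open>Subdividing every edge raises the domination number\<close>

lemma connected_third_neighbour:
  assumes G: "simple_graph G" "connected_graph G" and uv: "adjacent G u v"
    and n: "order_of G \<ge> 3"
  obtains w where "w \<noteq> u" "w \<noteq> v" "adjacent G v w \<or> adjacent G u w"
proof (rule ccontr)
  assume "\<not> thesis"
  with that have no: "adjacent G x y \<Longrightarrow> x \<in> {u, v} \<Longrightarrow> y \<in> {u, v}" for x y by blast
  \<comment> \<open>Without a further neighbour \<open>{u, v}\<close> is closed under adjacency, so
    by connectedness it contains every vertex.\<close>
  have "verts G \<subseteq> {u, v}"
  proof
    fix x assume "x \<in> verts G"
    then have "(adjacent G)\<^sup>*\<^sup>* u x"
      using G simple_graph_adjacentD[OF G(1) uv] by (auto simp: connected_graph_def)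
    then show "x \<in> {u, v}" by induction (auto dest: no)
  qed
  then have "card (verts G) \<le> card {u, v}" by (intro card_mono) auto
  also have "\<dots> \<le> 2" by (simp add: card_insert_le_m1)
  finally show False using n by (simp add: order_of_def)
qed

lemma domination_number_subdivide_all:
  assumes G: "simple_graph G" "connected_graph G" "order_of G \<ge> 3"
  shows "\<gamma> G < \<gamma> (subdivide G (edges G))"
proof -
  let ?E = "edges G"
  obtain A B where AB: "dominating (subdivide G ?E) (Inl ` A \<union> Inr ` B)"
    and fin: "finite A" "finite B" and card: "\<gamma> (subdivide G ?E) = card A + card B"
    using minimum_dominating_subdivideE[OF G(1) order_refl] by blast
  \<comment> \<open>No original edge survives, so a vertex outside \<open>A\<close> can be dominated
    only by a subdivision vertex.\<close>
  have A: "A \<subseteq> verts G" and B: "B \<subseteq> ?E"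
    and cover: "\<And>v. v \<in> verts G \<Longrightarrow> v \<notin> A \<Longrightarrow> \<exists>e\<in>B. v \<in> e"
    and touch: "\<And>e. e \<in> ?E \<Longrightarrow> e \<notin> B \<Longrightarrow> \<exists>u\<in>A. u \<in> e"
    using AB by (auto simp: dominating_subdivide_iff)
  have edge: "adjacent G x y" if "e \<in> B" "x \<in> e" "y \<in> e" "x \<noteq> y" for e x y
    using simple_graph_adjacentI[OF G(1)] that B by blast
  have inV: "x \<in> verts G" if "e \<in> B" "x \<in> e" for e x
    using simple_graph_edge_subset[OF G(1)] that B by blast
  define c where "c e = (SOME x. x \<in> e)" for e :: "'a set"
  have c: "c e \<in> e" if "e \<in> B" for e
  proof -
    have "\<exists>x. x \<in> e" using simple_graph_edge_nonempty[OF G(1)] that B by blast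
    then show ?thesis unfolding c_def by (rule someI_ex)
  qed
  have bound: "card (A' \<union> c' ` B') \<le> card A' + card B'" if "finite B'"
    for A' B' and c' :: "'a set \<Rightarrow> 'a"
    by (meson that add_left_mono card_Un_le card_image_le order_trans)
  have small: "\<exists>D. dominating G D \<and> card D < card A + card B"
  proof (cases "B = {}")
    case True
    with A cover have AV: "A = verts G" by blast
    obtain x where x: "x \<in> verts G" using G by (auto simp: connected_graph_def)
    have "\<exists>y. adjacent G x y"
    proof (rule ccontr)
      assume no: "\<nexists>y. adjacent G x y"
      have "verts G \<subseteq> {x}"
      proof
        fix y assume "y \<in> verts G"
        then have "(adjacent G)\<^sup>*\<^sup>* x y" using G(2) x by (auto simp: connected_graph_def)
        then show "y \<in> {x}" by (cases rule: converse_rtranclpE) (use no in auto)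
      qed
      then have "card (verts G) \<le> card {x}" by (intro card_mono) auto
      with G(3) show False by (simp add: order_of_def)
    qed
    then have "dominating G (A - {x})"
      using AV simple_graph_adjacentD[OF G(1)] by (fastforce simp: dominating_def)
    moreover have "card (A - {x}) < card A" using x AV fin by (metis card_Diff1_less)
    ultimately show ?thesis using True by auto
  next
    case False
    show ?thesis
    proof (cases "\<exists>e\<in>B. e \<inter> A \<noteq> {}")
      case True
      then obtain e u where e: "e \<in> B" "u \<in> e" "u \<in> A" by blast
      \<comment> \<open>The end \<open>u\<close> of \<open>e\<close> is already in \<open>A\<close>
        and dominates the other end, so \<open>e\<close> contributes nothing new.\<close>
      have "dominating G (A \<union> c ` (B - {e}))"
        unfolding dominating_def
      proof (intro conjI ballI)
        show "A \<union> c ` (B - {e}) \<subseteq> verts G" using A c inV by blast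
        fix v assume v: "v \<in> verts G - (A \<union> c ` (B - {e}))"
        then obtain f where f: "f \<in> B" "v \<in> f" using cover by blast
        show "\<exists>u\<in>A \<union> c ` (B - {e}). adjacent G v u"
        proof (cases "f = e")
          case True
          then show ?thesis using e f v edge[of e v u] by blast
        next
          case False
          then show ?thesis using f v c[of f] edge[of f v "c f"] by blast
        qed
      qed
      moreover have "card (A \<union> c ` (B - {e})) < card A + card B"
        using bound[of "B - {e}" A c] fin card_Diff1_less[OF fin(2) e(1)] by simp
      ultimately show ?thesis by blast
    next
      case disj: False
      from False obtain e where e: "e \<in> B" by blast
      with B obtain u0 v0 where uv0: "e = {u0, v0}" "adjacent G u0 v0"
        using simple_graph_edgeE[OF G(1)] by (metis subsetD)
      obtain w where w: "w \<noteq> u0" "w \<noteq> v0" "adjacent G v0 w \<or> adjacent G u0 w"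
        using connected_third_neighbour[OF G(1,2) uv0(2) G(3)] by blast
      \<comment> \<open>The third vertex may hang on either end of \<open>e\<close>;
        \<open>v\<close> names the end it is adjacent to.\<close>
      then obtain v where v: "v \<in> e" "adjacent G v w" using uv0 by blast
      then have wv: "adjacent G w v" by (simp add: adjacent_sym)
      have we: "w \<notin> e" using w uv0 by blast
      have "v \<notin> A" using disj e v by blast
      \<comment> \<open>The choice of ends is altered at \<open>e\<close> alone, to force
        \<open>v\<close> into the new set.\<close>
      define d where "d = c(e := v)"
      have d: "d f \<in> f" if "f \<in> B" for f using c that v by (simp add: d_def)
      have de: "v = d e" by (simp add: d_def)
      show ?thesis
      proof (cases "w \<in> A")
        case True
        \<comment> \<open>Dropping \<open>w\<close> harms no other vertex: those outside
          \<open>A\<close> lie on edges of \<open>B\<close> and are dominated by the chosen ends.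
          \<open>w\<close> itself is adjacent to \<open>v\<close>.\<close>
        have "dominating G (A - {w} \<union> d ` B)"
          unfolding dominating_def
        proof (intro conjI ballI)
          show "A - {w} \<union> d ` B \<subseteq> verts G" using A d inV by blast
          fix x assume x: "x \<in> verts G - (A - {w} \<union> d ` B)"
          show "\<exists>u\<in>A - {w} \<union> d ` B. adjacent G x u"
          proof (cases "x = w")
            case True
            then show ?thesis using wv de e by blast
          next
            case False
            then obtain f where f: "f \<in> B" "x \<in> f" using cover x by blast
            then show ?thesis using x d[of f] edge[of f x "d f"] by blast
          qed
        qed
        moreover have "card (A - {w} \<union> d ` B) < card A + card B"
          using bound[of B "A - {w}" d] fin card_Diff1_less[OF fin(1) True] by simp
        ultimately show ?thesis by blast
      next
        case False
        define f where "f = {v, w}"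
        have "f \<in> ?E" using v(2) by (simp add: f_def adjacent_def)
        \<comment> \<open>Neither end of \<open>f\<close> is in \<open>A\<close>, so its subdivision
          vertex can only be dominated by itself.\<close>
        then have f: "f \<in> B" using touch[of f] False \<open>v \<notin> A\<close> by (auto simp: f_def)
        have "f \<noteq> e" using we by (auto simp: f_def)
        \<comment> \<open>\<open>v\<close> stays in the set as the replacement of \<open>e\<close>,
          and it dominates \<open>w\<close>; both ends of \<open>f\<close> are thus taken care of
          without replacing \<open>f\<close>.\<close>
        have vD: "v \<in> d ` (B - {f})" using de e \<open>f \<noteq> e\<close> by blast
        have "dominating G (A \<union> d ` (B - {f}))"
          unfolding dominating_def
        proof (intro conjI ballI)
          show "A \<union> d ` (B - {f}) \<subseteq> verts G" using A d inV by blast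
          fix x assume x: "x \<in> verts G - (A \<union> d ` (B - {f}))"
          then obtain g where g: "g \<in> B" "x \<in> g" using cover by blast
          show "\<exists>u\<in>A \<union> d ` (B - {f}). adjacent G x u"
          proof (cases "g = f")
            case True
            then have "x = w" using g x vD by (auto simp: f_def)
            then show ?thesis using vD wv by blast
          next
            case False
            then show ?thesis using g x d[of g] edge[of g x "d g"] by blast
          qed
        qed
        moreover have "card (A \<union> d ` (B - {f})) < card A + card B"
          using bound[of "B - {f}" A d] fin card_Diff1_less[OF fin(2) f] by simp
        ultimately show ?thesis by blast
      qed
    qed
  qed
  then show ?thesis using domination_number_le card by (metis le_less_trans)
qed

text \<open>The witness of size \<open>q - 1\<close> keeps the domination number, so it cannot be
  the whole edge set. Hence \<open>q - 1 < card (edges G)\<close>, where the subtraction is exact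
  because \<open>q \<ge> 1\<close>.\<close>

lemma critical_le_card_edges:
  assumes "critical q G"
  shows "q \<le> card (edges G)"
proof -
  have G: "simple_graph G" "connected_graph G" "order_of G \<ge> 3" "q \<ge> 1"
    using assms by (auto simp: critical_def)
  obtain F where F: "F \<subseteq> edges G" "card F = q - 1" "\<gamma> (subdivide G F) = \<gamma> G"
    using assms by (auto simp: critical_def)
  have "F \<noteq> edges G" using F(3) domination_number_subdivide_all[OF G(1-3)] by auto
  then have "card F < card (edges G)"
    using F(1) finite_edges[OF G(1)] by (simp add: psubset_card_mono psubset_eq)
  with F(2) show ?thesis by simp
qed

lemma tree_card_edges:
  assumes "is_tree G"
  shows "card (edges G) \<le> order_of G - 1"
  using acyclic_card_edges[of G] assms
  by (auto simp: is_tree_def connected_graph_def order_of_def)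

section \<open>Paths\<close>

definition path_graph :: "nat \<Rightarrow> nat ugraph" where
  "path_graph n = \<lparr>verts = {..<n}, edges = {{i, Suc i} |i. Suc i < n}\<rparr>"

lemma verts_path_graph [simp]: "verts (path_graph n) = {..<n}"
  by (simp add: path_graph_def)

lemma order_of_path_graph [simp]: "order_of (path_graph n) = n"
  by (simp add: order_of_def)

lemma adjacent_path_graph:
  "adjacent (path_graph n) i j \<longleftrightarrow> i < n \<and> j < n \<and> (j = Suc i \<or> i = Suc j)"
  by (auto simp: adjacent_def path_graph_def doubleton_eq_iff)

lemma is_tree_path_graph:
  assumes "n > 0"
  shows "is_tree (path_graph n)"
  unfolding is_tree_def
proof (intro conjI notI)
  show "simple_graph (path_graph n)"
    by (auto simp: simple_graph_def path_graph_def)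
  \<comment> \<open>Every vertex is reached from 0; symmetry and transitivity then connect all
    pairs.\<close>
  have reach: "(adjacent (path_graph n))\<^sup>*\<^sup>* 0 i" if "i < n" for i
    using that
  proof (induction i)
    case (Suc i)
    then have "adjacent (path_graph n) i (Suc i)" by (simp add: adjacent_path_graph)
    with Suc show ?case by (meson Suc_lessD rtranclp.rtrancl_into_rtrancl)
  qed simp
  have "symp (adjacent (path_graph n))" by (rule sympI) (simp add: adjacent_sym)
  then have "symp (adjacent (path_graph n))\<^sup>*\<^sup>*" by (rule symp_rtranclp)
  then show "connected_graph (path_graph n)"
    using assms reach unfolding connected_graph_def
    by (metis empty_iff lessThan_iff rtranclp_trans sympD verts_path_graph)
next
  assume "\<exists>p. is_cycle (path_graph n) p"
  then obtain p where p: "length p \<ge> 3" "distinct p"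
    and adj: "\<And>i. i < length p \<Longrightarrow> adjacent (path_graph n) (p ! i) (p ! (Suc i mod length p))"
    by (auto simp: is_cycle_def)
  \<comment> \<open>Both neighbours on the cycle of its largest vertex \<open>m\<close> would have to be \<open>m - 1\<close>.\<close>
  have "Max (set p) \<in> set p" using p by (intro Max_in) auto
  then obtain i where i: "i < length p" "p ! i = Max (set p)" by (metis in_set_conv_nth)
  \<comment> \<open>\<open>j\<close> and \<open>k\<close> are the cyclic predecessor and successor
    of position \<open>i\<close>; they differ because a cycle has at least three entries.\<close>
  define j where "j = (if i = 0 then length p - 1 else i - 1)"
  define k where "k = Suc i mod length p"
  have j: "j < length p" "Suc j mod length p = i" using i by (auto simp: j_def)
  have k: "k < length p" unfolding k_def using p by (intro mod_less_divisor) auto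
  have "j \<noteq> k"
  proof (cases "Suc i = length p")
    case True
    then show ?thesis using p by (auto simp: j_def k_def)
  next
    case False
    then have "k = Suc i" using i by (simp add: k_def)
    then show ?thesis using p by (auto simp: j_def)
  qed
  moreover have "p ! j \<le> p ! i" "p ! k \<le> p ! i" using i j k by auto
  then have "p ! i = Suc (p ! j)" "p ! i = Suc (p ! k)"
    using adj[OF j(1)] adj[OF i(1)] j(2) by (auto simp: adjacent_path_graph k_def)
  ultimately show False using p(2) j k by (simp add: nth_eq_iff_index_eq)
qed

section \<open>The paths on three and four vertices\<close>

lemma edges_path_graph_3: "edges (path_graph 3) = {{0, 1}, {1, 2}}"
proof -
  have "Suc i < 3 \<longleftrightarrow> i = 0 \<or> i = 1" for i by auto
  then show ?thesis by (auto simp: path_graph_def numeral_2_eq_2)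
qed

lemma edges_path_graph_4: "edges (path_graph 4) = {{0, 1}, {1, 2}, {2, 3}}"
proof -
  have "Suc i < 4 \<longleftrightarrow> i = 0 \<or> i = 1 \<or> i = 2" for i by auto
  then show ?thesis by (auto simp: path_graph_def numeral_2_eq_2 numeral_3_eq_3)
qed

lemma domination_number_pos:
  assumes "simple_graph G" "verts G \<noteq> {}"
  shows "\<gamma> G \<ge> 1"
proof -
  obtain D where D: "dominating G D" "card D = \<gamma> G" by (rule minimum_dominating_setE)
  then have "D \<subseteq> verts G" "D \<noteq> {}" using assms by (auto simp: dominating_def)
  moreover from this have "finite D" using assms by (auto simp: simple_graph_def finite_subset)
  ultimately have "card D \<noteq> 0" by simp
  with D(2) show ?thesis by simp
qed

text \<open>A single vertex dominates only if it is adjacent to all others. This supplies the lower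
  bounds for both extremal paths.\<close>

lemma domination_number_ge_2:
  assumes "simple_graph G" "verts G \<noteq> {}"
    and "\<And>u. u \<in> verts G \<Longrightarrow> \<exists>v\<in>verts G. v \<noteq> u \<and> \<not> adjacent G v u"
  shows "\<gamma> G \<ge> 2"
proof (rule ccontr)
  assume "\<not> ?thesis"
  with domination_number_pos[OF assms(1,2)] have "\<gamma> G = 1" by simp
  then obtain u where "dominating G {u}"
    by (metis minimum_dominating_setE card_1_singletonE)
  with assms(3)[of u] show False by (fastforce simp: dominating_def)
qed

lemma simple_graph_subdivide:
  assumes "simple_graph G" "F \<subseteq> edges G"
  shows "simple_graph (subdivide G F)"
  using assms finite_subset[OF assms(2) finite_edges[OF assms(1)]]
  by (fastforce simp: simple_graph_def subdivide_def card_image)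

lemma critical_path_graph_3: "critical 1 (path_graph 3)"
proof -
  let ?G = "path_graph 3"
  have G: "simple_graph ?G" "connected_graph ?G"
    using is_tree_path_graph[of 3] by (auto simp: is_tree_def)
  have V: "{..<3::nat} = {0, 1, 2}" by auto
  have "dominating ?G {1}" by (auto simp: dominating_def adjacent_path_graph)
  then have g1: "\<gamma> ?G = 1"
    using domination_number_le[of ?G "{1}"] domination_number_pos[OF G(1)] by (simp add: V)
  have ge: "\<gamma> (subdivide ?G F) \<ge> 2" if F1: "F \<subseteq> edges ?G" "card F = 1" for F
  proof (rule domination_number_ge_2[OF simple_graph_subdivide[OF G(1) F1(1)]])
    obtain e where "F = {e}" using F1(2) by (rule card_1_singletonE)
    then have F: "F = {{0, 1}} \<or> F = {{1, 2}}" using F1(1) by (auto simp: edges_path_graph_3)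
    show "verts (subdivide ?G F) \<noteq> {}" by (simp add: verts_subdivide V)
    fix u assume u: "u \<in> verts (subdivide ?G F)"
    let ?bad = "\<lambda>v. v \<noteq> u \<and> \<not> adjacent (subdivide ?G F) v u"
    \<comment> \<open>After one subdivision the graph is a path on four vertices whose ends 0 and 2
      are at distance 3, so no vertex is equal or adjacent to both.\<close>
    have "?bad (Inl 0) \<or> ?bad (Inl 2)"
    proof (cases u)
      case (Inl i)
      then have "i = 0 \<or> i = 1 \<or> i = 2" using u by (auto simp: verts_subdivide V)
      with F Inl show ?thesis by (auto simp: edges_path_graph_3 doubleton_eq_iff)
    next
      case (Inr e)
      with F show ?thesis by auto
    qed
    moreover have "Inl 0 \<in> verts (subdivide ?G F)" "Inl 2 \<in> verts (subdivide ?G F)"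
      by (simp_all add: verts_subdivide V)
    ultimately show "\<exists>v\<in>verts (subdivide ?G F). ?bad v" by blast
  qed
  have "\<gamma> ?G < \<gamma> (subdivide ?G F)" if "F \<subseteq> edges ?G" "card F = 1" for F
    using g1 ge[OF that] by linarith
  \<comment> \<open>For \<open>q = 1\<close> the witness is the empty set. The equality still needs
    an argument, since subdividing changes the vertex type; the centre dominates again.\<close>
  moreover have "\<gamma> (subdivide ?G {}) = \<gamma> ?G"
  proof (rule antisym)
    have "dominating (subdivide ?G {}) (Inl ` {1} \<union> Inr ` {})"
      unfolding dominating_subdivide_iff by (auto simp: V edges_path_graph_3 doubleton_eq_iff)
    then show "\<gamma> (subdivide ?G {}) \<le> \<gamma> ?G" using g1 domination_number_le by fastforce
  qed (use domination_number_le_subdivide[OF G(1), of "{}"] in simp)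
  ultimately show ?thesis using G unfolding critical_def by auto
qed

lemma critical_path_graph_4: "critical 3 (path_graph 4)"
proof -
  let ?G = "path_graph 4"
  have T: "is_tree ?G" by (rule is_tree_path_graph) simp
  then have G: "simple_graph ?G" "connected_graph ?G" by (auto simp: is_tree_def)
  have V: "{..<4::nat} = {0, 1, 2, 3}" by auto
  have ge: "\<gamma> ?G \<ge> 2"
  proof (rule domination_number_ge_2[OF G(1)])
    show "\<exists>v\<in>verts ?G. v \<noteq> u \<and> \<not> adjacent ?G v u" for u
      \<comment> \<open>Each vertex misses the end of the path on the opposite side.\<close>
      by (rule bexI[of _ "if u \<ge> 2 then 0 else 3"]) (auto simp: adjacent_path_graph)
  qed (simp add: V)
  have strict: "\<gamma> ?G < \<gamma> (subdivide ?G F)" if F: "F \<subseteq> edges ?G" "card F = 3" for F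
  proof -
    \<comment> \<open>A tree on four vertices has at most three edges, so three edges are all of
      them.\<close>
    have "F = edges ?G"
      using F tree_card_edges[OF T] finite_edges[OF G(1)] by (intro card_seteq) auto
    then show ?thesis using domination_number_subdivide_all[OF G] by simp
  qed
  have "\<gamma> (subdivide ?G {{0, 1}, {1, 2}}) = \<gamma> ?G" (is "\<gamma> (subdivide _ ?F) = _")
  proof (rule antisym)
    \<comment> \<open>The subdivision is a path on six vertices: the new vertex on
      \<open>{0, 1}\<close> dominates 0 and 1, and the vertex 2 dominates 3 and the new vertex on
      \<open>{1, 2}\<close>.\<close>
    have "dominating (subdivide ?G ?F) (Inl ` {2} \<union> Inr ` {{0, 1}})"
      unfolding dominating_subdivide_iff by (auto simp: V edges_path_graph_4 doubleton_eq_iff)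
    then show "\<gamma> (subdivide ?G ?F) \<le> \<gamma> ?G" using ge domination_number_le by fastforce
  qed (use domination_number_le_subdivide[OF G(1), of ?F] in \<open>simp add: edges_path_graph_4\<close>)
  moreover have "card {{0, 1}, {1, 2 :: nat}} = 3 - 1" by (simp add: doubleton_eq_iff)
  moreover have "{{0, 1}, {1, 2}} \<subseteq> edges ?G" by (auto simp: edges_path_graph_4)
  ultimately have "\<exists>F'. F' \<subseteq> edges ?G \<and> card F' = 3 - 1 \<and> \<gamma> (subdivide ?G F') = \<gamma> ?G"
    by blast
  with strict G show ?thesis by (simp add: critical_def)
qed

theorem corollary3p7:
  "(\<forall>(T :: 'a ugraph) (q :: nat).
      is_tree T \<and> order_of T \<ge> 3 \<and> q > 0 \<and> critical q T \<longrightarrow>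
      1 \<le> q \<and> q \<le> order_of T - 1) \<and>
   (\<exists>T :: nat ugraph. is_tree T \<and> order_of T \<ge> 3 \<and> critical 1 T) \<and>
   (\<exists>T :: nat ugraph. is_tree T \<and> order_of T \<ge> 3 \<and> critical (order_of T - 1) T)"
proof (intro conjI)
  show "\<forall>(T :: 'a ugraph) (q :: nat).
      is_tree T \<and> order_of T \<ge> 3 \<and> q > 0 \<and> critical q T \<longrightarrow> 1 \<le> q \<and> q \<le> order_of T - 1"
    using critical_le_card_edges tree_card_edges by fastforce
  show "\<exists>T :: nat ugraph. is_tree T \<and> order_of T \<ge> 3 \<and> critical 1 T"
    using critical_path_graph_3 by (intro exI[of _ "path_graph 3"]) (simp add: is_tree_path_graph)
  show "\<exists>T :: nat ugraph. is_tree T \<and> order_of T \<ge> 3 \<and> critical (order_of T - 1) T"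
    using critical_path_graph_4 by (intro exI[of _ "path_graph 4"]) (simp add: is_tree_path_graph)
qed

end
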